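(* Let $m,J,a>0$ and $b=0$, and let $E=m p_\theta^2+(J+ma^2)p_1^2$. In the neighborhood of the origin $O=(0,0)$ of the $(p_\theta,p_1)$-plane bounded by the condition $E<m^2a^2(J+ma^2)$, the discrete Chaplygin sleigh map $(p_{\theta,k},p_{1,k})\mapsto(p_{\theta,k+1},p_{1,k+1})$ is single-valued and has the following bi-asymptotic behavior for every orbit through a non-stationary point (i.e. one with $p_\theta\neq0$): for $k\to-\infty$, the point $(p_{\theta,k},p_{1,k})$ approaches, along the corresponding invariant ellipse $\{E=\mathrm{const}\}$, a point of the segment $\{p_\theta=0,\ -ma<p_1<0\}$ of unstable stationary points, and for $k\to+\infty$ the point $(p_{\theta,k},p_{1,k})$ approaches one of the points of the segment $\{p_\theta=0,\ 0<p_1<ma\}$ of stable stationary points. In both cases the sequence $\{(p_{\theta,k},p_{1,k})\}$ remains in one of the half-planes $p_\theta<0$ or $p_\theta>0$.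
   Context: The discrete Chaplygin sleigh map (case $b=0$). The state at step $k$ is an incremental displacement with rotation angle $\Delta\theta_k$ (modulo $2\pi$) and body-frame translation $(V_{1,k},V_{2,k})\in\mathbb R^2$, subject to the discrete constraint $$-V_{1,k}\sin(\Delta\theta_k/2)+V_{2,k}\cos(\Delta\theta_k/2)=0.$$ The discrete body momenta are $$p_{\theta,k}=(J+ma^2)\sin\Delta\theta_k+am\,V_{2,k},\qquad p_{1,k}=m\,V_{1,k}-am(1-\cos\Delta\theta_k),$$ and the momenta at the next step are $$p_{\theta,k+1}=p_{\theta,k}-2am\,V_{2,k},\qquad p_{1,k+1}=p_{1,k}+2am(1-\cos\Delta\theta_k).$$ Thus, given $(p_{\theta,k},p_{1,k})$, one finds $(\Delta\theta_k,V_{1,k},V_{2,k})$ satisfying the constraint with these momenta (in general not unique, so the map is in general multi-valued) and then computes $(p_{\theta,k+1},p_{1,k+1})$. The map preserves $E$, so orbits lie on the invariant ellipses $\{E=\mathrm{const}\}$, and points with $p_\theta=0$ (with $\Delta\theta=0$, $V_2=0$) are stationary. *)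

theory Defs
  imports "HOL-Analysis.Analysis"
begin

(* The parameters m, J, a are the mass, the moment of inertia and the offset of the sleigh; the
   second offset b is 0 throughout. Points of the momentum plane are pairs (p_theta, p_1). *)

(* The rotation angle is a real representative of its class modulo 2 pi: replacing theta by
   theta + 2 pi only changes the sign of the left-hand side of the constraint. *)
definition sleigh_constraint :: "real \<Rightarrow> real \<Rightarrow> real \<Rightarrow> bool" where
  "sleigh_constraint \<theta> V1 V2 \<longleftrightarrow> - V1 * sin (\<theta> / 2) + V2 * cos (\<theta> / 2) = 0"

definition sleigh_momenta ::
  "real \<Rightarrow> real \<Rightarrow> real \<Rightarrow> real \<Rightarrow> real \<Rightarrow> real \<Rightarrow> real \<times> real" where
  "sleigh_momenta m J a \<theta> V1 V2 =
     ((J + m * a\<^sup>2) * sin \<theta> + a * m * V2, m * V1 - a * m * (1 - cos \<theta>))"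

(* The multi-valued map, as a relation: Q is one of the images of P. *)
definition sleigh_step ::
  "real \<Rightarrow> real \<Rightarrow> real \<Rightarrow> real \<times> real \<Rightarrow> real \<times> real \<Rightarrow> bool" where
  "sleigh_step m J a P Q \<longleftrightarrow>
     (\<exists>\<theta> V1 V2. sleigh_constraint \<theta> V1 V2 \<and> P = sleigh_momenta m J a \<theta> V1 V2 \<and>
        Q = (fst P - 2 * a * m * V2, snd P + 2 * a * m * (1 - cos \<theta>)))"

definition sleigh_energy :: "real \<Rightarrow> real \<Rightarrow> real \<Rightarrow> real \<times> real \<Rightarrow> real" where
  "sleigh_energy m J a P = m * (fst P)\<^sup>2 + (J + m * a\<^sup>2) * (snd P)\<^sup>2"

definition sleigh_region :: "real \<Rightarrow> real \<Rightarrow> real \<Rightarrow> (real \<times> real) set" where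
  "sleigh_region m J a = {P. sleigh_energy m J a P < m\<^sup>2 * a\<^sup>2 * (J + m * a\<^sup>2)}"

definition sleigh_orbit :: "real \<Rightarrow> real \<Rightarrow> real \<Rightarrow> (int \<Rightarrow> real \<times> real) \<Rightarrow> bool" where
  "sleigh_orbit m J a p \<longleftrightarrow> (\<forall>k. sleigh_step m J a (p k) (p (k + 1)))"

definition stationary :: "('a \<Rightarrow> 'a \<Rightarrow> bool) \<Rightarrow> 'a \<Rightarrow> bool" where
  "stationary R x \<longleftrightarrow> R x x"

(* Lyapunov stability under forward iteration of a multi-valued map: all forward orbits that start
   close to x stay close to x. *)
definition lyapunov_stable :: "('a::topological_space \<Rightarrow> 'a \<Rightarrow> bool) \<Rightarrow> 'a \<Rightarrow> bool" where
  "lyapunov_stable R x \<longleftrightarrow>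
     (\<forall>U. open U \<and> x \<in> U \<longrightarrow>
        (\<exists>W. open W \<and> x \<in> W \<and>
           (\<forall>q :: nat \<Rightarrow> 'a. q 0 \<in> W \<and> (\<forall>n. R (q n) (q (Suc n))) \<longrightarrow> (\<forall>n. q n \<in> U))))"

end

theory Submission
  imports Defs
begin

text \<open>
  Put \<phi> = \<theta>/2. The constraint says that the translation points in direction \<phi>, that is
  V = u (cos \<phi>, sin \<phi>), so a step is described by the two numbers (\<phi>, u). In these coordinates
  a step and its time reversal differ only in the sign of u (\<open>sleigh_step_polar\<close>). Three facts
  carry the proof.

  First, with I = J + m a^2, the energy factorises as
  E = (J cos^2 \<phi> + m a^2) (4 m I sin^2 \<phi> + m^2 u^2). It is even in u, hence conserved, and below
  the threshold m^2 a^2 I it forces sin^2 \<phi> < 1/4.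

  Second, elimination of u in favour of t = tan \<phi> leaves one equation
  p_\<theta> = t (a p_1 + 2 m a^2 + 2 J / (1 + t^2)). The bracket is positive because |p_1| < m a, so the
  equation has a solution by the intermediate value theorem. The right-hand side need not be
  monotone in t on the whole line, but it is on t^2 < 1/3, which is where the energy bound puts
  every solution; hence the map is single-valued. The same positivity shows that p_\<theta> never
  changes sign.

  Third, p_1 never decreases: it grows by 4 a m sin^2 \<phi>. Being bounded by the energy it converges,
  so sin \<phi> tends to 0 and with it p_\<theta>; the limit is one of the two points of the ellipse on the p_1
  axis, and monotonicity leaves only the upper one. The reflection (p_\<theta>, p_1) \<mapsto> (p_\<theta>, -p_1)
  conjugates the map to its inverse, so every statement about the future turns into one about the
  past. Stability follows as well: for p_1 > 0 the growth of p_1 on a fixed ellipse shrinks |p_\<theta>|,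
  and for p_1 < 0 the nonstationary orbits travel to the other half of the ellipse.
\<close>

section \<open>Steps in polar coordinates\<close>

text \<open>Coordinates in which the two ends of a step are interchanged, up to the sign of the second
  momentum, by u \<mapsto> -u; the conservation law and the reversibility below are read off from them.\<close>

lemma sleigh_step_polar:
  "sleigh_step m J a P Q \<longleftrightarrow>
     (\<exists>\<phi> u. P = (sin \<phi> * (2 * (J + m * a\<^sup>2) * cos \<phi> + a * m * u),
                  m * u * cos \<phi> - 2 * a * m * (sin \<phi>)\<^sup>2) \<and>
             Q = (sin \<phi> * (2 * (J + m * a\<^sup>2) * cos \<phi> - a * m * u),
                  m * u * cos \<phi> + 2 * a * m * (sin \<phi>)\<^sup>2))"
    (is "_ \<longleftrightarrow> ?polar")
proof
  assume "sleigh_step m J a P Q"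
  then obtain \<theta> V1 V2 where con: "- V1 * sin (\<theta> / 2) + V2 * cos (\<theta> / 2) = 0"
    and P: "P = sleigh_momenta m J a \<theta> V1 V2"
    and Q: "Q = (fst P - 2 * a * m * V2, snd P + 2 * a * m * (1 - cos \<theta>))"
    unfolding sleigh_step_def sleigh_constraint_def by blast
  define \<phi> where "\<phi> = \<theta> / 2"
  define u where "u = V1 * cos \<phi> + V2 * sin \<phi>"
  have \<theta>: "\<theta> = 2 * \<phi>" and sc: "(sin \<phi>)\<^sup>2 + (cos \<phi>)\<^sup>2 = 1"
    by (simp_all add: \<phi>_def)
  have con': "V1 * sin \<phi> = V2 * cos \<phi>"
    using con by (simp add: \<phi>_def)
  have "V1 = V1 * ((sin \<phi>)\<^sup>2 + (cos \<phi>)\<^sup>2)"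
    by (simp add: sc)
  also have "\<dots> = u * cos \<phi>"
    unfolding u_def using con' by algebra
  finally have V1: "V1 = u * cos \<phi>" .
  have "V2 = V2 * ((sin \<phi>)\<^sup>2 + (cos \<phi>)\<^sup>2)"
    by (simp add: sc)
  also have "\<dots> = u * sin \<phi>"
    unfolding u_def using con' by algebra
  finally have V2: "V2 = u * sin \<phi>" .
  have double: "cos \<theta> = 1 - 2 * (sin \<phi>)\<^sup>2" "sin \<theta> = 2 * sin \<phi> * cos \<phi>"
    unfolding \<theta> by (simp_all add: cos_double_sin sin_double)
  show ?polar
    unfolding Q P sleigh_momenta_def V1 V2 double
    by (rule exI[of _ \<phi>], rule exI[of _ u]) (simp add: algebra_simps)
next
  assume ?polar
  then obtain \<phi> u where
    P: "P = (sin \<phi> * (2 * (J + m * a\<^sup>2) * cos \<phi> + a * m * u),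
             m * u * cos \<phi> - 2 * a * m * (sin \<phi>)\<^sup>2)"
    and Q: "Q = (sin \<phi> * (2 * (J + m * a\<^sup>2) * cos \<phi> - a * m * u),
             m * u * cos \<phi> + 2 * a * m * (sin \<phi>)\<^sup>2)"
    by blast
  have double: "cos (2 * \<phi>) = 1 - 2 * (sin \<phi>)\<^sup>2" "sin (2 * \<phi>) = 2 * sin \<phi> * cos \<phi>"
    by (simp_all add: cos_double_sin sin_double)
  show "sleigh_step m J a P Q"
    unfolding sleigh_step_def sleigh_constraint_def sleigh_momenta_def P Q
    by (rule exI[of _ "2 * \<phi>"], rule exI[of _ "u * cos \<phi>"], rule exI[of _ "u * sin \<phi>"],
        unfold double, simp add: algebra_simps)
qed

definition time_reflection :: "real \<times> real \<Rightarrow> real \<times> real" where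
  "time_reflection P = (fst P, - snd P)"

lemma time_reflection_simps [simp]:
  "fst (time_reflection P) = fst P" "snd (time_reflection P) = - snd P"
  "time_reflection (time_reflection P) = P"
  by (simp_all add: time_reflection_def)

lemma sleigh_energy_time_reflection [simp]:
  "sleigh_energy m J a (time_reflection P) = sleigh_energy m J a P"
  by (simp add: sleigh_energy_def)

lemma sleigh_region_time_reflection [simp]:
  "time_reflection P \<in> sleigh_region m J a \<longleftrightarrow> P \<in> sleigh_region m J a"
  by (simp add: sleigh_region_def)

text \<open>The step with the same \<phi> and the opposite u runs backwards through the reflected points.\<close>

lemma sleigh_step_time_reversal:
  assumes "sleigh_step m J a P Q"
  shows "sleigh_step m J a (time_reflection Q) (time_reflection P)"
proof -
  obtain \<phi> u where
    P: "P = (sin \<phi> * (2 * (J + m * a\<^sup>2) * cos \<phi> + a * m * u),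
          m * u * cos \<phi> - 2 * a * m * (sin \<phi>)\<^sup>2)"
    and Q: "Q = (sin \<phi> * (2 * (J + m * a\<^sup>2) * cos \<phi> - a * m * u),
          m * u * cos \<phi> + 2 * a * m * (sin \<phi>)\<^sup>2)"
    using assms unfolding sleigh_step_polar by blast
  show ?thesis
    unfolding P Q sleigh_step_polar time_reflection_def
    by (rule exI[of _ \<phi>], rule exI[of _ "- u"]) simp
qed

text \<open>The mixed terms in u cancel. The rest factorises because J cos^2 \<phi> + m a^2 equals
  I cos^2 \<phi> + m a^2 sin^2 \<phi> with I = J + m a^2.\<close>

lemma sleigh_energy_polar:
  fixes \<phi> u :: real
  shows "sleigh_energy m J a (sin \<phi> * (2 * (J + m * a\<^sup>2) * cos \<phi> + a * m * u),
                              m * u * cos \<phi> - 2 * a * m * (sin \<phi>)\<^sup>2) =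
    (J * (cos \<phi>)\<^sup>2 + m * a\<^sup>2) * (4 * m * (J + m * a\<^sup>2) * (sin \<phi>)\<^sup>2 + m\<^sup>2 * u\<^sup>2)"
proof -
  have "m * a\<^sup>2 * ((sin \<phi>)\<^sup>2 + (cos \<phi>)\<^sup>2) = m * a\<^sup>2" by simp
  then have D: "J * (cos \<phi>)\<^sup>2 + m * a\<^sup>2 = (J + m * a\<^sup>2) * (cos \<phi>)\<^sup>2 + m * a\<^sup>2 * (sin \<phi>)\<^sup>2"
    by (simp only: distrib_left distrib_right)
  show ?thesis
    unfolding sleigh_energy_def fst_conv snd_conv D by algebra
qed

lemma sleigh_energy_step:
  assumes "sleigh_step m J a P Q"
  shows "sleigh_energy m J a Q = sleigh_energy m J a P"
proof -
  obtain \<phi> u where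
    P: "P = (sin \<phi> * (2 * (J + m * a\<^sup>2) * cos \<phi> + a * m * u),
          m * u * cos \<phi> - 2 * a * m * (sin \<phi>)\<^sup>2)"
    and Q: "Q = (sin \<phi> * (2 * (J + m * a\<^sup>2) * cos \<phi> - a * m * u),
          m * u * cos \<phi> + 2 * a * m * (sin \<phi>)\<^sup>2)"
    using assms unfolding sleigh_step_polar by blast
  show ?thesis
    unfolding P Q sleigh_energy_def fst_conv snd_conv by algebra
qed

lemma sleigh_region_step:
  assumes "sleigh_step m J a P Q"
  shows "Q \<in> sleigh_region m J a \<longleftrightarrow> P \<in> sleigh_region m J a"
  using sleigh_energy_step[OF assms] by (simp add: sleigh_region_def)

context
  fixes m J a :: real
  assumes m: "m > 0" and J: "J > 0" and a: "a > 0"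
begin

lemma inertia_pos: "J + m * a\<^sup>2 > 0"
  using m J by (simp add: add_pos_nonneg)

lemma snd_mono_step:
  assumes "sleigh_step m J a P Q"
  shows "snd P \<le> snd Q"
proof -
  obtain \<theta> V2 where "Q = (fst P - 2 * a * m * V2, snd P + 2 * a * m * (1 - cos \<theta>))"
    using assms unfolding sleigh_step_def by blast
  then have "snd Q = snd P + 2 * a * m * (1 - cos \<theta>)" by simp
  moreover have "2 * a * m * (1 - cos \<theta>) \<ge> 0"
    using m a by (intro mult_nonneg_nonneg) auto
  ultimately show ?thesis by simp
qed

lemma snd_bound_energy:
  "(J + m * a\<^sup>2) * (snd P)\<^sup>2 \<le> sleigh_energy m J a P"
  using m by (simp add: sleigh_energy_def)

lemma snd_bound_region:
  assumes "P \<in> sleigh_region m J a"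
  shows "\<bar>snd P\<bar> < m * a"
proof -
  have "(J + m * a\<^sup>2) * (snd P)\<^sup>2 < (J + m * a\<^sup>2) * (m * a)\<^sup>2"
    using snd_bound_energy[of P] assms
    by (simp add: sleigh_region_def power_mult_distrib mult_ac)
  then have "(snd P)\<^sup>2 < (m * a)\<^sup>2"
    using inertia_pos by simp
  then show ?thesis
    using m a abs_le_square_iff[of "m * a" "snd P"] by (auto simp: not_le[symmetric])
qed

section \<open>The slope equation\<close>

text \<open>The ratio p_\<theta> / t for a step whose translation has slope t = tan(\<theta>/2) and that starts with
  p_1 = y.\<close>

definition slope_factor :: "real \<Rightarrow> real \<Rightarrow> real" where
  "slope_factor t y = a * y + 2 * m * a\<^sup>2 + 2 * J / (1 + t\<^sup>2)"

lemma slope_factor_offset_pos: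
  assumes "\<bar>y\<bar> < m * a"
  shows "a * y + 2 * m * a\<^sup>2 > 0"
proof -
  have "a * (- (m * a)) < a * y"
    using assms a by (intro mult_strict_left_mono) auto
  moreover have "m * a\<^sup>2 > 0"
    using m a by simp
  ultimately show ?thesis
    by (simp add: power2_eq_square algebra_simps)
qed

lemma slope_factor_ge_offset: "a * y + 2 * m * a\<^sup>2 \<le> slope_factor t y"
  using J by (simp add: slope_factor_def add_nonneg_nonneg)

lemma slope_factor_pos:
  assumes "\<bar>y\<bar> < m * a"
  shows "slope_factor t y > 0"
  using slope_factor_offset_pos[OF assms] slope_factor_ge_offset by (rule less_le_trans)

lemma inverse_one_plus_slope_square:
  fixes t \<phi> :: real
  assumes "sin \<phi> = t * cos \<phi>"
  shows "1 / (1 + t\<^sup>2) = (cos \<phi>)\<^sup>2"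
proof -
  have "(sin \<phi>)\<^sup>2 + (cos \<phi>)\<^sup>2 = 1" by simp
  then have "(1 + t\<^sup>2) * (cos \<phi>)\<^sup>2 = 1"
    unfolding assms by (simp add: power_mult_distrib distrib_right add.commute)
  moreover have "1 + t\<^sup>2 \<noteq> 0"
    using zero_le_power2[of t] by linarith
  ultimately show ?thesis
    by (simp add: divide_eq_eq mult.commute)
qed

lemma slope_factor_polar:
  assumes "sin \<phi> = t * cos \<phi>" and y: "y = m * u * cos \<phi> - 2 * a * m * (sin \<phi>)\<^sup>2"
  shows "slope_factor t y = cos \<phi> * (2 * (J + m * a\<^sup>2) * cos \<phi> + a * m * u)"
proof -
  have s2: "(sin \<phi>)\<^sup>2 = 1 - (cos \<phi>)\<^sup>2"
    using sin_cos_squared_add[of \<phi>] by linarith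
  have "slope_factor t y = a * y + 2 * m * a\<^sup>2 + 2 * J * (cos \<phi>)\<^sup>2"
    unfolding slope_factor_def inverse_one_plus_slope_square[OF assms(1), symmetric] by simp
  then show ?thesis
    unfolding y s2 by (simp add: algebra_simps power2_eq_square)
qed

text \<open>The slope exists and is small by the factorised energy, whose first factor is at least m a^2:
  the bound E < m^2 a^2 I leaves sin^2 \<phi> < 1/4, that is t^2 < 1/3. The image Q starts the reversed
  step, so it satisfies the same equation with -p_1 in place of p_1.\<close>

lemma sleigh_step_slope:
  assumes P: "P \<in> sleigh_region m J a" and step: "sleigh_step m J a P Q"
  obtains t where "t\<^sup>2 < 1 / 3"
    and "fst P = t * slope_factor t (snd P)"
    and "fst Q = t * slope_factor t (- snd Q)"
    and "snd Q = snd P + 4 * a * m * (t\<^sup>2 / (1 + t\<^sup>2))"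
proof -
  let ?I = "J + m * a\<^sup>2"
  obtain \<phi> u where
    Peq: "P = (sin \<phi> * (2 * ?I * cos \<phi> + a * m * u), m * u * cos \<phi> - 2 * a * m * (sin \<phi>)\<^sup>2)"
    and Qeq: "Q = (sin \<phi> * (2 * ?I * cos \<phi> - a * m * u), m * u * cos \<phi> + 2 * a * m * (sin \<phi>)\<^sup>2)"
    using step unfolding sleigh_step_polar by blast
  have sc: "(sin \<phi>)\<^sup>2 + (cos \<phi>)\<^sup>2 = 1" by simp
  have "m * a\<^sup>2 * (4 * m * ?I * (sin \<phi>)\<^sup>2)
      \<le> (J * (cos \<phi>)\<^sup>2 + m * a\<^sup>2) * (4 * m * ?I * (sin \<phi>)\<^sup>2 + m\<^sup>2 * u\<^sup>2)"
    using m J inertia_pos by (intro mult_mono) auto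
  also have "\<dots> < m\<^sup>2 * a\<^sup>2 * ?I"
    using P unfolding Peq sleigh_region_def mem_Collect_eq sleigh_energy_polar .
  finally have "(m\<^sup>2 * a\<^sup>2 * ?I) * (4 * (sin \<phi>)\<^sup>2) < (m\<^sup>2 * a\<^sup>2 * ?I) * 1"
    by (simp add: power2_eq_square mult_ac)
  moreover have "m\<^sup>2 * a\<^sup>2 * ?I > 0"
    using m a inertia_pos by simp
  ultimately have "4 * (sin \<phi>)\<^sup>2 < 1"
    using mult_less_cancel_left_pos by blast
  then have s: "(sin \<phi>)\<^sup>2 < 1 / 4" and c: "(cos \<phi>)\<^sup>2 > 3 / 4"
    using sc by linarith+
  then have c0: "cos \<phi> \<noteq> 0" by auto
  define t where "t = tan \<phi>"
  have st: "sin \<phi> = t * cos \<phi>"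
    using c0 by (simp add: t_def tan_def)
  have t2: "t\<^sup>2 / (1 + t\<^sup>2) = (sin \<phi>)\<^sup>2"
  proof -
    have "t\<^sup>2 / (1 + t\<^sup>2) = t\<^sup>2 * (1 / (1 + t\<^sup>2))" by simp
    also have "\<dots> = (sin \<phi>)\<^sup>2"
      unfolding inverse_one_plus_slope_square[OF st] st by (simp add: power_mult_distrib)
    finally show ?thesis .
  qed
  show thesis
  proof
    have "t\<^sup>2 * (3 / 4) \<le> t\<^sup>2 * (cos \<phi>)\<^sup>2"
      using c by (intro mult_left_mono) auto
    also have "\<dots> = (sin \<phi>)\<^sup>2"
      by (simp add: st power_mult_distrib)
    finally show "t\<^sup>2 < 1 / 3"
      using s by simp
    show "fst P = t * slope_factor t (snd P)"
      using slope_factor_polar[OF st, of "snd P" u] by (simp add: Peq st)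
    show "fst Q = t * slope_factor t (- snd Q)"
      using slope_factor_polar[OF st, of "- snd Q" "- u"] by (simp add: Qeq st)
    show "snd Q = snd P + 4 * a * m * (t\<^sup>2 / (1 + t\<^sup>2))"
      unfolding t2 by (simp add: Peq Qeq)
  qed
qed

lemma sleigh_step_of_slope:
  assumes x: "fst P = t * slope_factor t (snd P)"
  shows "\<exists>Q. sleigh_step m J a P Q"
proof -
  define \<phi> where "\<phi> = arctan t"
  define u where "u = (snd P + 2 * a * m * (sin \<phi>)\<^sup>2) / (m * cos \<phi>)"
  have c0: "cos \<phi> \<noteq> 0" by (simp add: \<phi>_def)
  have st: "sin \<phi> = t * cos \<phi>"
    using c0 tan_arctan[of t] by (simp add: \<phi>_def tan_def field_simps)
  have y: "snd P = m * u * cos \<phi> - 2 * a * m * (sin \<phi>)\<^sup>2"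
    using c0 m by (simp add: u_def)
  have "fst P = sin \<phi> * (2 * (J + m * a\<^sup>2) * cos \<phi> + a * m * u)"
    unfolding x slope_factor_polar[OF st y] by (simp add: st)
  with y have "P = (sin \<phi> * (2 * (J + m * a\<^sup>2) * cos \<phi> + a * m * u),
                    m * u * cos \<phi> - 2 * a * m * (sin \<phi>)\<^sup>2)"
    by (simp add: prod_eq_iff)
  then show ?thesis
    unfolding sleigh_step_polar by blast
qed

text \<open>The factor is at least a y + 2 m a^2 > 0, so t times the factor sweeps out the whole line.\<close>

lemma slope_exists:
  assumes y: "\<bar>y\<bar> < m * a"
  shows "\<exists>t. x = t * slope_factor t y"
proof -
  define B where "B = a * y + 2 * m * a\<^sup>2"
  have B: "B > 0"
    unfolding B_def by (rule slope_factor_offset_pos[OF y])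
  have ge: "slope_factor t y \<ge> B" for t
    unfolding B_def by (rule slope_factor_ge_offset)
  define T where "T = \<bar>x\<bar> / B"
  have T: "T \<ge> 0" using B by (simp add: T_def)
  have up: "T * slope_factor T y \<ge> \<bar>x\<bar>"
    using mult_left_mono[OF ge[of T] T] B by (simp add: T_def)
  have "slope_factor (- T) y = slope_factor T y"
    by (simp add: slope_factor_def)
  then have lo: "(- T) * slope_factor (- T) y \<le> - \<bar>x\<bar>"
    using up by simp
  have "continuous_on {- T..T} (\<lambda>t. t * slope_factor t y)"
    unfolding slope_factor_def
    by (intro continuous_intros) (metis add_pos_nonneg less_numeral_extra(1)
        less_numeral_extra(3) zero_le_power2 zero_less_one)
  then have "\<exists>t\<ge>- T. t \<le> T \<and> t * slope_factor t y = x"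
    using up lo T by (intro IVT') auto
  then show ?thesis by auto
qed

text \<open>The difference quotient of t times the factor is
  (a y + 2 m a^2) + 2 J (1 - s t) / ((1 + s^2) (1 + t^2)), and |s t| < 1/3.\<close>

lemma slope_unique:
  assumes y: "\<bar>y\<bar> < m * a" and s: "s\<^sup>2 < 1 / 3" and t: "t\<^sup>2 < 1 / 3"
    and eq: "s * slope_factor s y = t * slope_factor t y"
  shows "s = t"
proof -
  define B where "B = a * y + 2 * m * a\<^sup>2"
  have B: "B > 0"
    unfolding B_def by (rule slope_factor_offset_pos[OF y])
  have pos: "1 + s\<^sup>2 > 0" "1 + t\<^sup>2 > 0"
    by (simp_all add: add_pos_nonneg)
  have "(s - t)\<^sup>2 \<ge> 0" by simp
  then have st: "1 - s * t > 0"
    using s t by (simp add: power2_diff)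
  have fs: "s * slope_factor s y = s * B + 2 * J * (s / (1 + s\<^sup>2))" for s
    by (simp add: slope_factor_def B_def algebra_simps)
  have "s / (1 + s\<^sup>2) - t / (1 + t\<^sup>2) = (s - t) * (1 - s * t) / ((1 + s\<^sup>2) * (1 + t\<^sup>2))"
    using pos by (simp add: diff_frac_eq) (simp add: power2_eq_square algebra_simps)
  then have "s * slope_factor s y - t * slope_factor t y
      = (s - t) * (B + 2 * J * ((1 - s * t) / ((1 + s\<^sup>2) * (1 + t\<^sup>2))))"
    unfolding fs by (simp add: algebra_simps)
  moreover have "B + 2 * J * ((1 - s * t) / ((1 + s\<^sup>2) * (1 + t\<^sup>2))) > 0"
    using B J divide_pos_pos[OF st mult_pos_pos[OF pos]] by (intro add_pos_pos mult_pos_pos) auto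
  ultimately show ?thesis
    using eq by simp
qed

section \<open>The map on the region\<close>

lemma sleigh_step_exists:
  assumes "P \<in> sleigh_region m J a"
  shows "\<exists>Q. sleigh_step m J a P Q"
  using slope_exists[OF snd_bound_region[OF assms], of "fst P"] sleigh_step_of_slope by blast

lemma sleigh_step_unique:
  assumes P: "P \<in> sleigh_region m J a"
    and Q: "sleigh_step m J a P Q" and R: "sleigh_step m J a P R"
  shows "Q = R"
proof -
  obtain s where s: "s\<^sup>2 < 1 / 3" "fst P = s * slope_factor s (snd P)"
    "fst Q = s * slope_factor s (- snd Q)" "snd Q = snd P + 4 * a * m * (s\<^sup>2 / (1 + s\<^sup>2))"
    using sleigh_step_slope[OF P Q] .
  obtain t where t: "t\<^sup>2 < 1 / 3" "fst P = t * slope_factor t (snd P)"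
    "fst R = t * slope_factor t (- snd R)" "snd R = snd P + 4 * a * m * (t\<^sup>2 / (1 + t\<^sup>2))"
    using sleigh_step_slope[OF P R] .
  have "s = t"
    using slope_unique[OF snd_bound_region[OF P] s(1) t(1)] s(2) t(2) by simp
  then show ?thesis
    using s(3,4) t(3,4) by (simp add: prod_eq_iff)
qed

lemma sleigh_stationary_axis: "stationary (sleigh_step m J a) (0, y)"
  unfolding stationary_def sleigh_step_polar
  by (rule exI[of _ 0], rule exI[of _ "y / m"], use m in simp)

lemma sleigh_stationary_iff:
  assumes P: "P \<in> sleigh_region m J a"
  shows "stationary (sleigh_step m J a) P \<longleftrightarrow> fst P = 0"
proof
  assume "stationary (sleigh_step m J a) P"
  then have "sleigh_step m J a P P" by (simp add: stationary_def)
  then obtain t where t: "fst P = t * slope_factor t (snd P)"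
    "snd P = snd P + 4 * a * m * (t\<^sup>2 / (1 + t\<^sup>2))"
    using sleigh_step_slope[OF P] by metis
  have "1 + t\<^sup>2 \<noteq> 0"
    using zero_le_power2[of t] by linarith
  then have "t = 0" using t(2) a m by simp
  then show "fst P = 0" using t(1) by simp
next
  assume "fst P = 0"
  then show "stationary (sleigh_step m J a) P"
    using sleigh_stationary_axis[of "snd P"] by (metis prod.collapse)
qed

text \<open>Both values of p_\<theta> are t times a positive factor.\<close>

lemma sgn_fst_step:
  assumes P: "P \<in> sleigh_region m J a" and step: "sleigh_step m J a P Q"
  shows "sgn (fst Q) = sgn (fst P)"
proof -
  obtain t where t: "fst P = t * slope_factor t (snd P)" "fst Q = t * slope_factor t (- snd Q)"
    using sleigh_step_slope[OF P step] by metis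
  have Q: "Q \<in> sleigh_region m J a"
    using sleigh_region_step[OF step] P by simp
  have "slope_factor t (snd P) > 0" "slope_factor t (- snd Q) > 0"
    using slope_factor_pos snd_bound_region[OF P] snd_bound_region[OF Q] by simp_all
  then show ?thesis
    unfolding t by (simp add: sgn_mult)
qed

section \<open>Forward orbits\<close>

lemma forward_orbit_exists:
  assumes "P \<in> sleigh_region m J a"
  shows "\<exists>q. q 0 = P \<and> (\<forall>n::nat. sleigh_step m J a (q n) (q (Suc n)))"
proof -
  have "\<exists>q. \<forall>n::nat. (q n \<in> sleigh_region m J a \<and> (n = 0 \<longrightarrow> q n = P))
      \<and> sleigh_step m J a (q n) (q (Suc n))"
  proof (rule dependent_nat_choice)
    fix x and n :: nat
    assume "x \<in> sleigh_region m J a \<and> (n = 0 \<longrightarrow> x = P)"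
    then obtain y where "sleigh_step m J a x y"
      using sleigh_step_exists by blast
    then show "\<exists>y. (y \<in> sleigh_region m J a \<and> (Suc n = 0 \<longrightarrow> y = P)) \<and> sleigh_step m J a x y"
      using sleigh_region_step \<open>x \<in> sleigh_region m J a \<and> (n = 0 \<longrightarrow> x = P)\<close> by blast
  qed (use assms in blast)
  then show ?thesis by blast
qed

lemma forward_orbit_energy:
  assumes "\<And>n. sleigh_step m J a (q n) (q (Suc n))"
  shows "sleigh_energy m J a (q n) = sleigh_energy m J a (q 0)"
  by (induction n) (simp_all add: sleigh_energy_step[OF assms])

lemma forward_orbit_snd_mono:
  assumes "\<And>n. sleigh_step m J a (q n) (q (Suc n))"
  shows "incseq (\<lambda>n. snd (q n))"
  using snd_mono_step[OF assms] by (intro incseq_SucI)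

text \<open>The increments of p_1 are proportional to t^2/(1 + t^2) and tend to 0 because p_1 converges;
  they dominate p_\<theta>^2. Of the two points of the ellipse on the axis only the upper one can be the
  limit, as p_1 starts strictly above the lower one.\<close>

lemma forward_orbit_converges:
  assumes q0: "q 0 \<in> sleigh_region m J a" "fst (q 0) \<noteq> 0"
    and step: "\<And>n. sleigh_step m J a (q n) (q (Suc n))"
  shows "\<exists>L. 0 < L \<and> L < m * a \<and> q \<longlonglongrightarrow> (0, L)"
proof -
  let ?I = "J + m * a\<^sup>2"
  let ?E = "sleigh_energy m J a (q 0)"
  \<comment> \<open>an upper bound for the slope factor when p_1 is at most m a\<close>
  define C where "C = 3 * m * a\<^sup>2 + 2 * J"
  have energy: "sleigh_energy m J a (q n) = ?E" for n
    by (rule forward_orbit_energy[of q, OF step])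
  have region: "q n \<in> sleigh_region m J a" for n
    using q0(1) energy[of n] by (simp add: sleigh_region_def)
  have bound: "\<bar>snd (q n)\<bar> < m * a" for n
    by (rule snd_bound_region[OF region])
  have inc: "incseq (\<lambda>n. snd (q n))"
    by (rule forward_orbit_snd_mono[of q, OF step])
  obtain L where L: "(\<lambda>n. snd (q n)) \<longlonglongrightarrow> L" and le_L: "\<And>n. snd (q n) \<le> L"
    using incseq_convergent[OF inc, of "m * a"] bound by (metis abs_less_iff less_imp_le)
  have dominated: "(fst (q n))\<^sup>2 \<le> C\<^sup>2 / (3 * a * m) * (snd (q (Suc n)) - snd (q n))" for n
  proof -
    obtain t where t: "t\<^sup>2 < 1 / 3" "fst (q n) = t * slope_factor t (snd (q n))"
      "snd (q (Suc n)) = snd (q n) + 4 * a * m * (t\<^sup>2 / (1 + t\<^sup>2))"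
      using sleigh_step_slope[OF region step] by metis
    have pos: "slope_factor t (snd (q n)) > 0"
      by (rule slope_factor_pos[OF bound])
    have "a * snd (q n) \<le> a * (m * a)"
      using bound[of n] a by (intro mult_left_mono) auto
    moreover have "2 * J / (1 + t\<^sup>2) \<le> 2 * J"
      using J by (simp add: divide_le_eq add_pos_nonneg algebra_simps)
    ultimately have le: "slope_factor t (snd (q n)) \<le> C"
      by (simp add: slope_factor_def C_def power2_eq_square algebra_simps)
    have "t\<^sup>2 * (3 * (1 + t\<^sup>2)) \<le> t\<^sup>2 * 4"
      using t(1) by (intro mult_left_mono) auto
    then have t2: "t\<^sup>2 \<le> 4 / 3 * (t\<^sup>2 / (1 + t\<^sup>2))"
      by (simp add: field_simps add_pos_nonneg)
    have "(fst (q n))\<^sup>2 = t\<^sup>2 * (slope_factor t (snd (q n)))\<^sup>2"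
      by (simp add: t(2) power_mult_distrib)
    also have "\<dots> \<le> (4 / 3 * (t\<^sup>2 / (1 + t\<^sup>2))) * C\<^sup>2"
      using t2 pos le by (intro mult_mono power_mono) auto
    also have "\<dots> = C\<^sup>2 / (3 * a * m) * (snd (q (Suc n)) - snd (q n))"
      using a m by (simp add: t(3))
    finally show ?thesis .
  qed
  have "(\<lambda>n. C\<^sup>2 / (3 * a * m) * (snd (q (Suc n)) - snd (q n)))
      \<longlonglongrightarrow> C\<^sup>2 / (3 * a * m) * (L - L)"
    using L LIMSEQ_Suc[OF L] by (intro tendsto_intros)
  then have sq: "(\<lambda>n. (fst (q n))\<^sup>2) \<longlonglongrightarrow> 0"
    by (intro tendsto_sandwich[OF _ always_eventually[OF allI[OF dominated]] tendsto_const]) auto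
  then have x: "(\<lambda>n. fst (q n)) \<longlonglongrightarrow> 0"
    using tendsto_real_sqrt[OF sq] by (simp add: tendsto_rabs_zero_iff)
  have "(\<lambda>n. m * (fst (q n))\<^sup>2 + ?I * (snd (q n))\<^sup>2) \<longlonglongrightarrow> m * 0 + ?I * L\<^sup>2"
    using sq L by (intro tendsto_intros)
  moreover have "m * (fst (q n))\<^sup>2 + ?I * (snd (q n))\<^sup>2 = ?E" for n
    using energy[of n] by (simp add: sleigh_energy_def)
  ultimately have EL: "?E = ?I * L\<^sup>2"
    by (simp add: LIMSEQ_const_iff)
  have "?I * L\<^sup>2 < ?I * (m * a)\<^sup>2"
    using q0(1) EL by (simp add: sleigh_region_def power_mult_distrib mult_ac)
  then have "L\<^sup>2 < (m * a)\<^sup>2"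
    using inertia_pos by simp
  then have upper: "L < m * a"
    using m a by (simp add: power2_less_imp_less)
  have "m * (fst (q 0))\<^sup>2 > 0"
    using m q0(2) by simp
  then have "?I * (snd (q 0))\<^sup>2 < ?I * L\<^sup>2"
    unfolding EL[symmetric] by (simp add: sleigh_energy_def)
  then have "(snd (q 0))\<^sup>2 < L\<^sup>2"
    using inertia_pos by simp
  then have lower: "0 < L"
    using le_L[of 0] abs_le_square_iff[of L "snd (q 0)"] by (auto simp: not_le[symmetric])
  have "(\<lambda>n. (fst (q n), snd (q n))) \<longlonglongrightarrow> (0, L)"
    by (rule tendsto_Pair[OF x L])
  then show ?thesis
    using lower upper by auto
qed

section \<open>Stability of the stationary points\<close>

lemma axis_in_region:
  assumes "\<bar>y\<bar> < m * a"
  shows "(0, y) \<in> sleigh_region m J a"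
proof -
  have "y\<^sup>2 < (m * a)\<^sup>2"
    using assms by (metis abs_ge_zero power2_abs power_strict_mono pos2)
  then have "(J + m * a\<^sup>2) * y\<^sup>2 < (J + m * a\<^sup>2) * (m * a)\<^sup>2"
    using inertia_pos by simp
  then show ?thesis
    by (simp add: sleigh_region_def sleigh_energy_def power_mult_distrib mult_ac)
qed

lemma continuous_sleigh_energy: "continuous_on UNIV (sleigh_energy m J a)"
  unfolding sleigh_energy_def by (intro continuous_intros)

lemma open_sleigh_region: "open (sleigh_region m J a)"
  unfolding sleigh_region_def
  by (intro open_Collect_less continuous_sleigh_energy continuous_on_const)

text \<open>Along an orbit that starts near (0, y), p_1 lies between its initial value and the top of the
  ellipse, both close to y, and |p_\<theta>| never exceeds its initial value.\<close>

lemma upper_axis_stable: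
  assumes y: "y > 0"
  shows "lyapunov_stable (sleigh_step m J a) (0, y)"
  unfolding lyapunov_stable_def
proof (intro allI impI)
  fix U :: "(real \<times> real) set"
  let ?I = "J + m * a\<^sup>2"
  assume "open U \<and> (0, y) \<in> U"
  then obtain A B where AB: "open A" "open B" "0 \<in> A" "y \<in> B" "A \<times> B \<subseteq> U"
    by (metis open_prod_elim mem_Sigma_iff)
  obtain d where d: "d > 0" "\<And>x. \<bar>x\<bar> < d \<Longrightarrow> x \<in> A"
    using AB(1,3) unfolding open_dist dist_real_def by (metis diff_zero)
  obtain e where e: "e > 0" "\<And>x. \<bar>x - y\<bar> < e \<Longrightarrow> x \<in> B"
    using AB(2,4) unfolding open_dist dist_real_def by metis
  define W where "W = {P. \<bar>fst P\<bar> < d} \<inter> {P. max 0 (y - e) < snd P}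
      \<inter> {P. sleigh_energy m J a P < ?I * (y + e)\<^sup>2}"
  have "open W"
    unfolding W_def
    by (intro open_Int open_Collect_less continuous_sleigh_energy continuous_intros)
  moreover have "(0, y) \<in> W"
  proof -
    have "y\<^sup>2 < (y + e)\<^sup>2"
      using y e(1) by (intro power_strict_mono) auto
    then show ?thesis
      using y d(1) e(1) inertia_pos by (simp add: W_def sleigh_energy_def)
  qed
  moreover have "q n \<in> U"
    if q: "q 0 \<in> W" "\<forall>n. sleigh_step m J a (q n) (q (Suc n))" for q n
  proof -
    have energy: "sleigh_energy m J a (q n) = sleigh_energy m J a (q 0)"
      using q(2) by (intro forward_orbit_energy) auto
    have mono: "snd (q 0) \<le> snd (q n)"
      using forward_orbit_snd_mono[of q] q(2) by (auto dest: incseqD)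
    have low: "snd (q 0) > 0" "snd (q 0) > y - e" and x0: "\<bar>fst (q 0)\<bar> < d"
      and E0: "sleigh_energy m J a (q 0) < ?I * (y + e)\<^sup>2"
      using q(1) by (auto simp: W_def)
    have "?I * (snd (q n))\<^sup>2 < ?I * (y + e)\<^sup>2"
      using snd_bound_energy[of "q n"] energy E0 by linarith
    then have "(snd (q n))\<^sup>2 < (y + e)\<^sup>2"
      using inertia_pos by simp
    then have "snd (q n) < y + e"
      using y e(1) by (simp add: power2_less_imp_less)
    then have "snd (q n) \<in> B"
      using low(2) mono by (intro e(2)) auto
    moreover have "fst (q n) \<in> A"
    proof -
      have "(snd (q 0))\<^sup>2 \<le> (snd (q n))\<^sup>2"
        using mono low(1) by (intro power_mono) auto
      then have "?I * (snd (q 0))\<^sup>2 \<le> ?I * (snd (q n))\<^sup>2"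
        using inertia_pos by simp
      then have "m * (fst (q n))\<^sup>2 \<le> m * (fst (q 0))\<^sup>2"
        using energy unfolding sleigh_energy_def by linarith
      then have "\<bar>fst (q n)\<bar> \<le> \<bar>fst (q 0)\<bar>"
        using m by (simp add: abs_le_square_iff)
      then show ?thesis
        using x0 by (intro d(2)) linarith
    qed
    ultimately show ?thesis
      using AB(5) by (metis mem_Sigma_iff prod.collapse subsetD)
  qed
  ultimately show "\<exists>W. open W \<and> (0, y) \<in> W \<and>
      (\<forall>q. q 0 \<in> W \<and> (\<forall>n. sleigh_step m J a (q n) (q (Suc n))) \<longrightarrow> (\<forall>n. q n \<in> U))"
    by blast
qed

text \<open>Arbitrarily close to (0, y) there are points with p_\<theta> \<noteq> 0, and their forward orbits reach
  p_1 > 0.\<close>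

lemma lower_axis_unstable:
  assumes y: "- (m * a) < y" "y < 0"
  shows "\<not> lyapunov_stable (sleigh_step m J a) (0, y)"
proof
  assume stable: "lyapunov_stable (sleigh_step m J a) (0, y)"
  have "open {P :: real \<times> real. snd P < 0}"
    by (intro open_Collect_less continuous_intros)
  moreover have "(0, y) \<in> {P. snd P < 0}"
    using y(2) by simp
  ultimately have "open {P :: real \<times> real. snd P < 0} \<and> (0, y) \<in> {P. snd P < 0}" ..
  from stable[unfolded lyapunov_stable_def, THEN spec, THEN mp, OF this] obtain W where W: "open W" "(0, y) \<in> W"
    and stays: "\<forall>q. q 0 \<in> W \<and> (\<forall>n. sleigh_step m J a (q n) (q (Suc n)))
                  \<longrightarrow> (\<forall>n. q n \<in> {P. snd P < 0})"
    by (elim exE conjE)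
  have "open (W \<inter> sleigh_region m J a)" "(0, y) \<in> W \<inter> sleigh_region m J a"
    using W open_sleigh_region axis_in_region[of y] y by auto
  then obtain A B where AB: "open A" "0 \<in> A" "y \<in> B" "A \<times> B \<subseteq> W \<inter> sleigh_region m J a"
    by (metis open_prod_elim mem_Sigma_iff)
  obtain d where d: "d > 0" "\<And>x. \<bar>x\<bar> < d \<Longrightarrow> x \<in> A"
    using AB(1,2) unfolding open_dist dist_real_def by (metis diff_zero)
  have P: "(d / 2, y) \<in> W \<inter> sleigh_region m J a"
    using AB(3,4) d(1) d(2)[of "d / 2"] by auto
  then obtain q where q: "q 0 = (d / 2, y)" "\<And>n. sleigh_step m J a (q n) (q (Suc n))"
    using forward_orbit_exists by blast
  then obtain L where L: "0 < L" "q \<longlonglongrightarrow> (0, L)"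
    using forward_orbit_converges[of q] P d(1) by auto
  have "(\<lambda>n. snd (q n)) \<longlonglongrightarrow> L"
    using tendsto_snd[OF L(2)] by simp
  then have "L \<le> 0"
    using stays P q by (intro LIMSEQ_le_const2) (auto intro!: less_imp_le)
  with L(1) show False by simp
qed

section \<open>Two-sided orbits\<close>

text \<open>A two-sided orbit consists of a forward orbit of P and the reflection of a forward orbit of
  the reflected point.\<close>

lemma sleigh_orbit_exists:
  assumes P: "P \<in> sleigh_region m J a"
  shows "\<exists>p. sleigh_orbit m J a p \<and> p 0 = P"
proof -
  obtain q where q: "q 0 = P" "\<And>n. sleigh_step m J a (q n) (q (Suc n))"
    using forward_orbit_exists[OF P] by blast
  obtain r where r: "r 0 = time_reflection P" "\<And>n. sleigh_step m J a (r n) (r (Suc n))"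
    using forward_orbit_exists[of "time_reflection P"] P by auto
  define p where "p k = (if k \<ge> 0 then q (nat k) else time_reflection (r (nat (- k))))" for k
  have "sleigh_step m J a (p k) (p (k + 1))" for k
  proof (cases "k \<ge> 0")
    case True
    then show ?thesis
      using q(2)[of "nat k"] by (simp add: p_def nat_add_distrib)
  next
    case False
    have "p (k + 1) = time_reflection (r (nat (- (k + 1))))"
      using False q(1) r(1) by (auto simp: p_def)
    moreover have "nat (- k) = Suc (nat (- (k + 1)))"
      using False by simp
    ultimately show ?thesis
      using False sleigh_step_time_reversal[OF r(2)[of "nat (- (k + 1))"]] by (simp add: p_def)
  qed
  moreover have "p 0 = P"
    using q(1) by (simp add: p_def)
  ultimately show ?thesis
    unfolding sleigh_orbit_def by blast
qed

lemma step_invariant_on_orbit: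
  fixes p :: "int \<Rightarrow> 'b" and f :: "'b \<Rightarrow> 'c"
  assumes "\<And>k. f (p (k + 1)) = f (p k)"
  shows "f (p k) = f (p j)"
proof (induction k rule: int_induct[of _ j])
  case (step2 i)
  then show ?case using assms[of "i - 1"] by simp
qed (simp_all add: assms)

text \<open>Both ends are instances of \<open>forward_orbit_converges\<close>, the past one for the reflected orbit
  run backwards.\<close>

lemma sleigh_orbit_asymptotics:
  assumes P: "P \<in> sleigh_region m J a" "fst P \<noteq> 0"
    and orbit: "sleigh_orbit m J a p" "p j = P"
  shows "sleigh_energy m J a (p k) = sleigh_energy m J a P"
    and "\<exists>S \<in> {0} \<times> {- (m * a)<..<0}. (p \<longlongrightarrow> S) at_bot"
    and "\<exists>S \<in> {0} \<times> {0<..<m * a}. (p \<longlongrightarrow> S) at_top"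
    and "(\<forall>k. fst (p k) < 0) \<or> (\<forall>k. fst (p k) > 0)"
proof -
  have step: "sleigh_step m J a (p k) (p (k + 1))" for k
    using orbit(1) by (simp add: sleigh_orbit_def)
  have energy: "sleigh_energy m J a (p k) = sleigh_energy m J a P" for k
    using step_invariant_on_orbit[of "sleigh_energy m J a" p k j] sleigh_energy_step[OF step] orbit(2)
    by simp
  then show "sleigh_energy m J a (p k) = sleigh_energy m J a P" .
  have region: "p k \<in> sleigh_region m J a" for k
    using P(1) energy[of k] by (simp add: sleigh_region_def)
  have sgn: "sgn (fst (p k)) = sgn (fst P)" for k
    using step_invariant_on_orbit[of "\<lambda>x. sgn (fst x)" p k j] sgn_fst_step[OF region step] orbit(2)
    by simp
  then show "(\<forall>k. fst (p k) < 0) \<or> (\<forall>k. fst (p k) > 0)"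
    using P(2) by (metis linorder_neqE_linordered_idom sgn_greater sgn_less)
  have nz: "fst (p k) \<noteq> 0" for k
    using sgn[of k] P(2) by (metis sgn_0_0)
  show "\<exists>S \<in> {0} \<times> {0<..<m * a}. (p \<longlongrightarrow> S) at_top"
  proof -
    define q where "q n = p (int n)" for n
    have "sleigh_step m J a (q n) (q (Suc n))" for n
      using step[of "int n"] by (simp add: q_def add.commute)
    then obtain L where L: "0 < L" "L < m * a" "q \<longlonglongrightarrow> (0, L)"
      using forward_orbit_converges[of q] region nz by (auto simp: q_def)
    have "((\<lambda>k. q (nat k)) \<longlongrightarrow> (0, L)) at_top"
      by (rule filterlim_compose[OF L(3) filterlim_nat_sequentially])
    moreover have "\<forall>\<^sub>F k in at_top. q (nat k) = p k"
      using eventually_ge_at_top[of 0] by eventually_elim (simp add: q_def)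
    ultimately have "(p \<longlongrightarrow> (0, L)) at_top"
      by (rule Lim_transform_eventually)
    then show ?thesis using L(1,2) by (intro bexI[of _ "(0, L)"]) auto
  qed
  show "\<exists>S \<in> {0} \<times> {- (m * a)<..<0}. (p \<longlongrightarrow> S) at_bot"
  proof -
    define q where "q n = time_reflection (p (- int n))" for n
    have "sleigh_step m J a (q n) (q (Suc n))" for n
      using sleigh_step_time_reversal[OF step[of "- int (Suc n)"]] by (simp add: q_def)
    then obtain L where L: "0 < L" "L < m * a" "q \<longlonglongrightarrow> (0, L)"
      using forward_orbit_converges[of q] region nz by (auto simp: q_def)
    have "(\<lambda>n. time_reflection (q n)) \<longlonglongrightarrow> (0, - L)"
      using tendsto_Pair[OF tendsto_fst[OF L(3)] tendsto_minus[OF tendsto_snd[OF L(3)]]]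
      by (simp add: time_reflection_def)
    moreover have "filterlim (\<lambda>k. nat (- k)) sequentially at_bot"
      unfolding filterlim_at_top eventually_at_bot_linorder
      by (metis int_nat_eq le_minus_iff nat_le_iff nat_mono nat_int)
    ultimately have "((\<lambda>k. time_reflection (q (nat (- k)))) \<longlongrightarrow> (0, - L)) at_bot"
      by (rule filterlim_compose)
    moreover have "\<forall>\<^sub>F k in at_bot. time_reflection (q (nat (- k))) = p k"
      using eventually_le_at_bot[of 0] by eventually_elim (simp add: q_def)
    ultimately have "(p \<longlongrightarrow> (0, - L)) at_bot"
      by (rule Lim_transform_eventually)
    then show ?thesis using L(1,2) by (intro bexI[of _ "(0, - L)"]) auto
  qed
qed

end

section \<open>Bi-asymptotic behaviour of the sleigh map\<close>

theorem theorem7p4: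
  fixes m J a :: real
  assumes "m > 0" and "J > 0" and "a > 0"
  shows "(\<forall>P \<in> sleigh_region m J a. \<exists>!Q. sleigh_step m J a P Q) \<and>
    (\<forall>P \<in> sleigh_region m J a. stationary (sleigh_step m J a) P \<longleftrightarrow> fst P = 0) \<and>
    (\<forall>S \<in> {0} \<times> {- (m * a)<..<0}.
       stationary (sleigh_step m J a) S \<and> \<not> lyapunov_stable (sleigh_step m J a) S) \<and>
    (\<forall>S \<in> {0} \<times> {0<..<m * a}.
       stationary (sleigh_step m J a) S \<and> lyapunov_stable (sleigh_step m J a) S) \<and>
    (\<forall>P \<in> sleigh_region m J a. fst P \<noteq> 0 \<longrightarrow>
       (\<exists>p j. sleigh_orbit m J a p \<and> p j = P) \<and>
       (\<forall>p j. sleigh_orbit m J a p \<and> p j = P \<longrightarrow>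
          (\<forall>k. sleigh_energy m J a (p k) = sleigh_energy m J a P) \<and>
          (\<exists>S \<in> {0} \<times> {- (m * a)<..<0}. (p \<longlongrightarrow> S) at_bot) \<and>
          (\<exists>S \<in> {0} \<times> {0<..<m * a}. (p \<longlongrightarrow> S) at_top) \<and>
          ((\<forall>k. fst (p k) < 0) \<or> (\<forall>k. fst (p k) > 0))))"
proof (intro conjI ballI impI)
  fix P assume P: "P \<in> sleigh_region m J a"
  show "\<exists>!Q. sleigh_step m J a P Q"
    using sleigh_step_exists[OF assms P] sleigh_step_unique[OF assms P] by blast
  show "stationary (sleigh_step m J a) P \<longleftrightarrow> fst P = 0"
    by (rule sleigh_stationary_iff[OF assms P])
next
  fix S :: "real \<times> real" assume "S \<in> {0} \<times> {- (m * a)<..<0}"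
  then obtain y where S: "S = (0, y)" "- (m * a) < y" "y < 0" by auto
  show "stationary (sleigh_step m J a) S"
    unfolding S(1) by (rule sleigh_stationary_axis[OF assms])
  show "\<not> lyapunov_stable (sleigh_step m J a) S"
    unfolding S(1) by (rule lower_axis_unstable[OF assms S(2,3)])
next
  fix S :: "real \<times> real" assume "S \<in> {0} \<times> {0<..<m * a}"
  then obtain y where S: "S = (0, y)" "0 < y" by auto
  show "stationary (sleigh_step m J a) S"
    unfolding S(1) by (rule sleigh_stationary_axis[OF assms])
  show "lyapunov_stable (sleigh_step m J a) S"
    unfolding S(1) by (rule upper_axis_stable[OF assms S(2)])
next
  fix P assume P: "P \<in> sleigh_region m J a" "fst P \<noteq> 0"
  show "\<exists>p j. sleigh_orbit m J a p \<and> p j = P"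
    using sleigh_orbit_exists[OF assms P(1)] by blast
  show "\<forall>p j. sleigh_orbit m J a p \<and> p j = P \<longrightarrow>
          (\<forall>k. sleigh_energy m J a (p k) = sleigh_energy m J a P) \<and>
          (\<exists>S \<in> {0} \<times> {- (m * a)<..<0}. (p \<longlongrightarrow> S) at_bot) \<and>
          (\<exists>S \<in> {0} \<times> {0<..<m * a}. (p \<longlongrightarrow> S) at_top) \<and>
          ((\<forall>k. fst (p k) < 0) \<or> (\<forall>k. fst (p k) > 0))"
    using sleigh_orbit_asymptotics[OF assms P] by blast
qed

end
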